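(* Let $r\in(0,\infty)$, let $I=[a,b]$ with $a<b$, and let $f:I\to\mathbb{R}$ be a function of $r$-bounded variation. (1) If $r\in(0,1]$, then $f$ can be written as the difference of two monotone functions on $I$. Additionally, for $r=1$ the inverse implication also holds: every function $I\to\mathbb{R}$ that is the difference of two monotone functions is of $1$-bounded variation. (2) If $r\in(1,\infty)$, $\inf(I)=0$, and the function $\Phi:[0,\ell(I)]\to\mathbb{R}_+$ defined by $$\Phi(u):=\sup_{x,\,x+u\in I}\Big\{{}^{r}v_f(x+u)-{}^{r}v_f(x)\Big\}^{1/r}$$ is concave, then there exists a nondecreasing majorant $g:I\to\mathbb{R}$ of $f$ such that for all $x\in I$, $$\Phi(x)\le g(x)-f(x)\le 2\Phi\Big(\frac{x}{2}\Big).$$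
   Context: $\mathbb{R}_+=[0,\infty)$ and $\ell(I)=b-a$. For an interval $[s,t]$ and a partition $P=\{s=x_0<\cdots<x_n=t\}$, put $V^r_{[s,t]}(f,P)=\sum_{i=1}^n|f(x_i)-f(x_{i-1})|^r$ and $V^r_{[s,t]}(f)=\sup_P V^r_{[s,t]}(f,P)$. $f$ is of $r$-bounded variation on $[a,b]$ if $V^r_{[a,b]}(f)<\infty$. The $r$-variation function of $f$ is ${}^{r}v_f(x)=V^r_{[a,x]}(f)$ for $x\in I$, with ${}^{r}v_f(a)=0$; it is nondecreasing. A majorant of $f$ is a function $g$ with $g\ge f$ on $I$. *)

theory Defs
  imports "HOL-Analysis.Analysis"
begin

text \<open>A pair \<open>(n, x)\<close> encodes the partition \<open>s = x 0 < \<dots> < x n = t\<close>; values of \<open>x\<close> beyond \<open>n\<close> are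
  irrelevant. For \<open>s < t\<close> this forces \<open>n \<ge> 1\<close>, and for \<open>s = t\<close> only the trivial partition with
  \<open>n = 0\<close> remains.\<close>

definition partitions :: "real \<Rightarrow> real \<Rightarrow> (nat \<times> (nat \<Rightarrow> real)) set" where
  "partitions s t = {(n, x). x 0 = s \<and> x n = t \<and> (\<forall>i<n. x i < x (Suc i))}"

definition variation_sum :: "real \<Rightarrow> (real \<Rightarrow> real) \<Rightarrow> nat \<times> (nat \<Rightarrow> real) \<Rightarrow> real" where
  "variation_sum r f P = (case P of (n, x) \<Rightarrow> \<Sum>i=1..n. \<bar>f (x i) - f (x (i - 1))\<bar> powr r)"

definition variation :: "real \<Rightarrow> (real \<Rightarrow> real) \<Rightarrow> real \<Rightarrow> real \<Rightarrow> ennreal" where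
  "variation r f s t = (SUP P\<in>partitions s t. ennreal (variation_sum r f P))"

definition r_bounded_variation :: "real \<Rightarrow> (real \<Rightarrow> real) \<Rightarrow> real \<Rightarrow> real \<Rightarrow> bool" where
  "r_bounded_variation r f a b \<longleftrightarrow> variation r f a b < \<infinity>"

text \<open>Real-valued; it agrees with the extended variation as soon as the latter is finite on
  \<open>[a, x]\<close>, in particular for \<open>x \<in> [a, b]\<close> when \<open>f\<close> is of \<open>r\<close>-bounded variation on \<open>[a, b]\<close>.\<close>

definition variation_fun :: "real \<Rightarrow> (real \<Rightarrow> real) \<Rightarrow> real \<Rightarrow> real \<Rightarrow> real" where
  "variation_fun r f a x = enn2real (variation r f a x)"

lemma variation_fun_left [simp]: "variation_fun r f a a = 0"
proof -
  have "n = 0" if "(n, x) \<in> partitions a a" for n x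
  proof (rule ccontr)
    assume "n \<noteq> 0"
    have step: "x i < x (Suc i)" if "i < n" for i
      using \<open>(n, x) \<in> partitions a a\<close> that by (simp add: partitions_def)
    have "x 0 < x (Suc k)" if "k < n" for k
      using that
    proof (induction k)
      case 0
      then show ?case using step[of 0] by simp
    next
      case (Suc k)
      then show ?case using step[of "Suc k"] by simp
    qed
    from this[of "n - 1"] \<open>n \<noteq> 0\<close> that show False
      by (simp add: partitions_def)
  qed
  then have "variation_sum r f P = 0" if "P \<in> partitions a a" for P
    using that by (cases P) (auto simp: variation_sum_def)
  then have "variation r f a a \<le> 0"
    unfolding variation_def by (intro SUP_least) simp
  then show ?thesis
    by (simp add: variation_fun_def)
qed

text \<open>The supremum runs over a nonempty set when \<open>0 \<le> u \<le> b - a\<close>, bounded above when \<open>f\<close> is of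
  \<open>r\<close>-bounded variation on \<open>[a, b]\<close>.\<close>

definition variation_modulus ::
    "real \<Rightarrow> (real \<Rightarrow> real) \<Rightarrow> real \<Rightarrow> real \<Rightarrow> real \<Rightarrow> real" where
  "variation_modulus r f a b u =
    Sup {(variation_fun r f a (x + u) - variation_fun r f a x) powr (1 / r) | x.
          x \<in> {a..b} \<and> x + u \<in> {a..b}}"

text \<open>Monotone in either direction.\<close>

definition monotone_fun_on :: "real set \<Rightarrow> (real \<Rightarrow> real) \<Rightarrow> bool" where
  "monotone_fun_on I g \<longleftrightarrow> mono_on I g \<or> antimono_on I g"

definition diff_of_monotone_on :: "real set \<Rightarrow> (real \<Rightarrow> real) \<Rightarrow> bool" where
  "diff_of_monotone_on I f \<longleftrightarrow>
    (\<exists>g h. monotone_fun_on I g \<and> monotone_fun_on I h \<and> (\<forall>x\<in>I. f x = g x - h x))"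

definition majorant_on :: "real set \<Rightarrow> (real \<Rightarrow> real) \<Rightarrow> (real \<Rightarrow> real) \<Rightarrow> bool" where
  "majorant_on I f g \<longleftrightarrow> (\<forall>x\<in>I. f x \<le> g x)"

end

theory Submission
  imports Defs
begin

text \<open>Appending the point \<open>t\<close> to partitions of \<open>[a, s]\<close> gives
  \<open>\<bar>f t - f s\<bar> powr r \<le> v t - v s\<close> for the variation function \<open>v\<close>.
  If \<open>r \<le> 1\<close>, superadditivity of \<open>u \<mapsto> u powr (1 / r)\<close> upgrades this to
  \<open>\<bar>f t - f s\<bar> \<le> v t powr (1 / r) - v s powr (1 / r)\<close>, so \<open>w = v powr (1 / r)\<close> and \<open>w - f\<close> are
  both nondecreasing. If \<open>r > 1\<close>, it says \<open>\<bar>f t - f s\<bar> \<le> \<Phi> (t - s)\<close>, and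
  \<open>g x = sup {f y + \<Phi> y | 0 \<le> y \<le> x}\<close> works, because
  \<open>f y + \<Phi> y - f x \<le> \<Phi> (x - y) + \<Phi> y \<le> 2 * \<Phi> (x / 2)\<close> by midpoint concavity.\<close>

section \<open>Partitions and appending an endpoint\<close>

lemma partitions_mono:
  assumes "(n, x) \<in> partitions s t" "i \<le> j" "j \<le> n"
  shows "x i \<le> x j"
  using assms(2,3)
proof (induction j rule: dec_induct)
  case (step j)
  then have "x j < x (Suc j)"
    using assms(1) by (simp add: partitions_def)
  with step show ?case by simp
qed simp

lemma partitions_in_interval:
  assumes "(n, x) \<in> partitions s t" "i \<le> n"
  shows "x i \<in> {s..t}"
  using partitions_mono[OF assms(1), of 0 i] partitions_mono[OF assms(1), of i n] assms
  by (auto simp: partitions_def)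

lemma partitions_append:
  assumes "(n, x) \<in> partitions a s" "s < t"
  shows "(Suc n, x(Suc n := t)) \<in> partitions a t"
  using assms by (auto simp: partitions_def less_Suc_eq)

lemma variation_sum_append:
  assumes "(n, x) \<in> partitions a s"
  shows "variation_sum r f (Suc n, x(Suc n := t)) =
    variation_sum r f (n, x) + \<bar>f t - f s\<bar> powr r"
  using assms by (auto simp: variation_sum_def partitions_def intro!: sum.cong)

text \<open>Moving a constant summand into a supremum requires a nonempty index set, since the empty
  supremum in \<open>ennreal\<close> is 0.\<close>

lemma partitions_nonempty:
  assumes "a \<le> s"
  shows "partitions a s \<noteq> {}"
proof (cases "a = s")
  case True
  then have "(0, \<lambda>_. a) \<in> partitions a s" by (simp add: partitions_def)
  then show ?thesis by blast
next
  case False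
  with assms have "(1, \<lambda>i. if i = 0 then a else s) \<in> partitions a s"
    by (simp add: partitions_def)
  then show ?thesis by blast
qed

section \<open>Increments of the variation function\<close>

lemma variation_superadd:
  assumes "a \<le> s" "s \<le> t"
  shows "variation r f a s + ennreal (\<bar>f t - f s\<bar> powr r) \<le> variation r f a t"
\<comment> \<open>Appending \<open>t\<close> needs \<open>s < t\<close> strictly; for
  \<open>s = t\<close> the added term is \<open>0 powr r = 0\<close>.\<close>
proof (cases "s = t")
  case False
  with assms have "s < t" by simp
  have "variation r f a s + ennreal (\<bar>f t - f s\<bar> powr r) =
      (SUP P\<in>partitions a s. ennreal (variation_sum r f P) + ennreal (\<bar>f t - f s\<bar> powr r))"
    unfolding variation_def
    by (rule ennreal_SUP_add_left[symmetric, OF partitions_nonempty]) (use assms in auto)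
  also have "\<dots> \<le> variation r f a t"
  proof (rule SUP_least)
    fix P assume P: "P \<in> partitions a s"
    obtain n x where [simp]: "P = (n, x)" by (cases P)
    have nn: "0 \<le> variation_sum r f (n, x)"
      by (auto simp: variation_sum_def intro!: sum_nonneg)
    have "ennreal (variation_sum r f P) + ennreal (\<bar>f t - f s\<bar> powr r) =
        ennreal (variation_sum r f (Suc n, x(Suc n := t)))"
      using P nn by (simp add: variation_sum_append ennreal_plus)
    also have "\<dots> \<le> variation r f a t"
      unfolding variation_def
      using partitions_append[of n x a s t] P \<open>s < t\<close> by (intro SUP_upper) simp
    finally show "ennreal (variation_sum r f P) + ennreal (\<bar>f t - f s\<bar> powr r)
      \<le> variation r f a t" .
  qed
  finally show ?thesis .
qed simp

text \<open>The real form of \<open>variation_superadd\<close>. As \<open>enn2real\<close> sends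
  \<infinity> to 0, it preserves the inequality and the sum only once both variations are known to
  be finite.\<close>

lemma variation_fun_increment:
  assumes "r_bounded_variation r f a b" "a \<le> s" "s \<le> t" "t \<le> b"
  shows "\<bar>f t - f s\<bar> powr r \<le> variation_fun r f a t - variation_fun r f a s"
proof -
  \<comment> \<open>Superadditivity from \<open>t\<close> to \<open>b\<close>, with the nonnegative
    increment dropped, bounds this by the variation on the whole interval.\<close>
  have fin: "variation r f a t < \<infinity>"
  proof -
    have "variation r f a t \<le> variation r f a t + ennreal (\<bar>f b - f t\<bar> powr r)" by simp
    also have "\<dots> \<le> variation r f a b"
      by (rule variation_superadd) (use assms in auto)
    also have "\<dots> < \<infinity>" using assms by (simp add: r_bounded_variation_def)
    finally show ?thesis .
  qed
  have le: "variation r f a s + ennreal (\<bar>f t - f s\<bar> powr r) \<le> variation r f a t"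
    by (rule variation_superadd) (use assms in auto)
  then have fin': "variation r f a s < \<infinity>"
    using fin by (metis add_top ennreal_add_eq_top infinity_ennreal_def less_top top.extremum_unique)
  have "enn2real (variation r f a s + ennreal (\<bar>f t - f s\<bar> powr r)) \<le> enn2real (variation r f a t)"
    using le fin by (intro enn2real_mono) auto
  then show ?thesis
    using fin' by (simp add: variation_fun_def enn2real_plus)
qed

lemma variation_fun_mono:
  assumes "r_bounded_variation r f a b" "a \<le> s" "s \<le> t" "t \<le> b"
  shows "variation_fun r f a s \<le> variation_fun r f a t"
  using variation_fun_increment[OF assms] powr_ge_zero[of "\<bar>f t - f s\<bar>" r] by linarith

text \<open>Taking \<open>r\<close>-th roots gives the estimate from which both ranges of
  \<open>r\<close> start.\<close>

lemma abs_diff_le_variation_fun_powr: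
  assumes "r_bounded_variation r f a b" "a \<le> s" "s \<le> t" "t \<le> b" "0 < r"
  shows "\<bar>f t - f s\<bar> \<le> (variation_fun r f a t - variation_fun r f a s) powr (1 / r)"
proof -
  have "\<bar>f t - f s\<bar> = (\<bar>f t - f s\<bar> powr r) powr (1 / r)"
    using assms(5) by (simp add: powr_powr)
  also have "\<dots> \<le> (variation_fun r f a t - variation_fun r f a s) powr (1 / r)"
    using variation_fun_increment[OF assms(1-4)] assms(5) by (intro powr_mono2) auto
  finally show ?thesis .
qed

section \<open>Differences of monotone functions\<close>

lemma powr_diff_le_diff_powr:
  fixes x y p :: real
  assumes "1 \<le> p" "0 \<le> x" "x \<le> y"
  shows "(y - x) powr p \<le> y powr p - x powr p"
proof (cases "y = 0")
  case False
  with assms have y: "0 < y" by simp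
  \<comment> \<open>The graph lies below its chord from the origin, because \<open>u / y\<close> is
    in [0, 1] and \<open>p\<close> is at least 1. Taking \<open>u\<close> as \<open>y - x\<close>
    and as \<open>x\<close>, the two chord values add up to \<open>y powr p\<close>.\<close>
  have le: "u powr p \<le> u / y * y powr p" if "0 \<le> u" "u \<le> y" for u
  proof -
    have "u powr p = (u / y) powr p * y powr p"
      using that y by (simp add: powr_divide)
    also have "(u / y) powr p \<le> (u / y) powr 1"
      using that y assms(1) by (intro powr_mono') auto
    finally show ?thesis using that y by (simp add: mult_right_mono)
  qed
  have "(y - x) powr p + x powr p \<le> (y - x) / y * y powr p + x / y * y powr p"
    using assms by (intro add_mono le) auto
  also have "\<dots> = y powr p"
    using y by (simp add: field_simps)
  finally show ?thesis by simp
qed (use assms in simp)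

text \<open>All increments of a monotone function have the same sign, so the sum telescopes.\<close>

lemma sum_abs_diff_monotone:
  assumes "monotone_fun_on {s..t} g" "(n, x) \<in> partitions s t"
  shows "(\<Sum>i=1..n. \<bar>g (x i) - g (x (i - 1))\<bar>) = \<bar>g t - g s\<bar>"
proof -
  have x: "x (i - 1) \<in> {s..t}" "x i \<in> {s..t}" "x (i - 1) \<le> x i" if "i \<in> {1..n}" for i
    using that partitions_in_interval[OF assms(2)] partitions_mono[OF assms(2), of "i - 1" i] by auto
  have st: "s \<in> {s..t}" "t \<in> {s..t}" "s \<le> t"
    using partitions_mono[OF assms(2), of 0 n] assms(2) by (auto simp: partitions_def)
  have tel: "(\<Sum>i=1..n. g (x i) - g (x (i - 1))) = g t - g s"
    using sum_telescope''[of 0 n "\<lambda>i. g (x i)"] assms(2)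
    by (simp add: partitions_def)
  show ?thesis
    using assms(1) unfolding monotone_fun_on_def
  proof
    assume "mono_on {s..t} g"
    then have "(\<Sum>i=1..n. \<bar>g (x i) - g (x (i - 1))\<bar>) = (\<Sum>i=1..n. g (x i) - g (x (i - 1)))"
      and "g s \<le> g t"
      using x st by (auto intro!: sum.cong simp: mono_onD)
    with tel show ?thesis by simp
  next
    assume "antimono_on {s..t} g"
    then have "(\<Sum>i=1..n. \<bar>g (x i) - g (x (i - 1))\<bar>) = (\<Sum>i=1..n. - (g (x i) - g (x (i - 1))))"
      and "g t \<le> g s"
      using x st by (auto intro!: sum.cong simp: monotone_on_def)
    with tel show ?thesis unfolding sum_negf by simp
  qed
qed

text \<open>The triangle inequality splits each sum into those of the two monotone functions, whose
  values are the same for every partition.\<close>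

lemma diff_of_monotone_on_imp_bounded_variation:
  assumes "diff_of_monotone_on {a..b} h"
  shows "r_bounded_variation 1 h a b"
proof -
  obtain g k where g: "monotone_fun_on {a..b} g" and k: "monotone_fun_on {a..b} k"
    and h: "\<And>x. x \<in> {a..b} \<Longrightarrow> h x = g x - k x"
    using assms by (auto simp: diff_of_monotone_on_def)
  have "variation 1 h a b \<le> ennreal (\<bar>g b - g a\<bar> + \<bar>k b - k a\<bar>)"
    unfolding variation_def
  proof (rule SUP_least)
    fix P assume P: "P \<in> partitions a b"
    obtain n x where [simp]: "P = (n, x)" by (cases P)
    have "variation_sum 1 h P \<le>
        (\<Sum>i=1..n. \<bar>g (x i) - g (x (i - 1))\<bar> + \<bar>k (x i) - k (x (i - 1))\<bar>)"
    proof -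
      have "\<bar>h (x i) - h (x (i - 1))\<bar> \<le>
          \<bar>g (x i) - g (x (i - 1))\<bar> + \<bar>k (x i) - k (x (i - 1))\<bar>" if "i \<in> {1..n}" for i
      proof -
        have "x i \<in> {a..b}" "x (i - 1) \<in> {a..b}"
          using that P partitions_in_interval[of n x a b] by auto
        then show ?thesis using h by simp
      qed
      then show ?thesis by (auto simp: variation_sum_def intro!: sum_mono)
    qed
    also have "\<dots> = \<bar>g b - g a\<bar> + \<bar>k b - k a\<bar>"
      using sum_abs_diff_monotone[OF g, of n x] sum_abs_diff_monotone[OF k, of n x] P
      by (simp add: sum.distrib)
    finally show "ennreal (variation_sum 1 h P) \<le> ennreal (\<bar>g b - g a\<bar> + \<bar>k b - k a\<bar>)"
      by (rule ennreal_leI)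
  qed
  then show ?thesis
    unfolding r_bounded_variation_def using ennreal_less_top order.strict_trans1 by force
qed

lemma bounded_variation_imp_diff_of_monotone_on:
  assumes "0 < r" "r \<le> 1" "r_bounded_variation r f a b"
  shows "diff_of_monotone_on {a..b} f"
proof -
  define w where "w x = variation_fun r f a x powr (1 / r)" for x
  have w: "\<bar>f t - f s\<bar> \<le> w t - w s" if "a \<le> s" "s \<le> t" "t \<le> b" for s t
  proof -
    have "\<bar>f t - f s\<bar> \<le> (variation_fun r f a t - variation_fun r f a s) powr (1 / r)"
      using abs_diff_le_variation_fun_powr assms that by blast
    also have "\<dots> \<le> w t - w s"
      unfolding w_def using assms that variation_fun_mono
      by (intro powr_diff_le_diff_powr) (auto simp: variation_fun_def)
    finally show ?thesis .
  qed
  \<comment> \<open>Increments of \<open>w\<close> dominate both 0 and the increments of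
    \<open>f\<close>.\<close>
  have "mono_on {a..b} w" "mono_on {a..b} (\<lambda>x. w x - f x)"
    using w by (fastforce intro!: mono_onI)+
  moreover have "f x = w x - (w x - f x)" for x by simp
  ultimately show ?thesis
    unfolding diff_of_monotone_on_def monotone_fun_on_def by blast
qed

section \<open>The modulus and the nondecreasing majorant\<close>

lemma abs_diff_le_variation_modulus:
  assumes "0 < r" "r_bounded_variation r f a b" "a \<le> s" "s \<le> t" "t \<le> b"
  shows "\<bar>f t - f s\<bar> \<le> variation_modulus r f a b (t - s)"
proof -
  let ?v = "variation_fun r f a"
  let ?S = "{(?v (x + (t - s)) - ?v x) powr (1 / r) | x. x \<in> {a..b} \<and> x + (t - s) \<in> {a..b}}"
  \<comment> \<open>A real \<open>Sup\<close> is known to bound its set only if the set is bounded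
    above; here \<open>?v\<close> is nonnegative and nondecreasing, so no increment exceeds
    \<open>?v b\<close>.\<close>
  have "bdd_above ?S"
  proof (rule bdd_aboveI, safe)
    fix x assume x: "x \<in> {a..b}" "x + (t - s) \<in> {a..b}"
    have "0 \<le> ?v x" by (simp add: variation_fun_def)
    moreover have "?v (x + (t - s)) \<le> ?v b" "?v x \<le> ?v (x + (t - s))"
      using x assms by (auto intro!: variation_fun_mono)
    ultimately show "(?v (x + (t - s)) - ?v x) powr (1 / r) \<le> ?v b powr (1 / r)"
      using assms(1) by (intro powr_mono2) auto
  qed
  moreover have "(?v t - ?v s) powr (1 / r) \<in> ?S"
    using assms by (auto intro!: exI[of _ s])
  ultimately have "(?v t - ?v s) powr (1 / r) \<le> variation_modulus r f a b (t - s)"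
    unfolding variation_modulus_def by (rule cSup_upper[rotated])
  with abs_diff_le_variation_fun_powr[OF assms(2-5,1)] show ?thesis by linarith
qed

text \<open>Variation no longer enters: any concave \<Phi> that controls the increments of
  \<open>f\<close> yields the majorant.\<close>

lemma concave_modulus_majorant:
  fixes \<Phi> f :: "real \<Rightarrow> real"
  assumes conc: "concave_on {0..b} \<Phi>"
    and mod: "\<And>s t. 0 \<le> s \<Longrightarrow> s \<le> t \<Longrightarrow> t \<le> b \<Longrightarrow> \<bar>f t - f s\<bar> \<le> \<Phi> (t - s)"
  shows "\<exists>g. mono_on {0..b} g \<and> majorant_on {0..b} f g \<and>
    (\<forall>x\<in>{0..b}. \<Phi> x \<le> g x - f x \<and> g x - f x \<le> 2 * \<Phi> (x / 2))"
proof -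
  define g where "g x = (SUP y\<in>{0..x}. f y + \<Phi> y)" for x
  \<comment> \<open>The points \<open>x - y\<close> and \<open>y\<close> have midpoint
    \<open>x / 2\<close> whatever \<open>y\<close> is. This uniform bound makes the supremum in
    \<open>g\<close> meaningful and also gives the upper estimate.\<close>
  have bound: "f y + \<Phi> y \<le> f x + 2 * \<Phi> (x / 2)" if "0 \<le> y" "y \<le> x" "x \<le> b" for x y
  proof -
    have "\<Phi> (x - y) / 2 + \<Phi> y / 2 \<le> \<Phi> ((x - y) / 2 + y / 2)"
      using concave_onD[OF conc, of "1 / 2" "x - y" y] that by simp
    also have "(x - y) / 2 + y / 2 = x / 2" by (simp add: field_simps)
    finally have "\<Phi> (x - y) + \<Phi> y \<le> 2 * \<Phi> (x / 2)" by linarith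
    moreover have "f y - f x \<le> \<Phi> (x - y)" using mod[of y x] that by simp
    ultimately show ?thesis by simp
  qed
  have bdd: "bdd_above ((\<lambda>y. f y + \<Phi> y) ` {0..x})" if "x \<le> b" for x
    using bound[of _ x] that by (intro bdd_aboveI2) auto
  \<comment> \<open>The choice \<open>y = x\<close> in the supremum.\<close>
  have lower: "\<Phi> x \<le> g x - f x" if "x \<in> {0..b}" for x
    using cSUP_upper[OF _ bdd, of x x] that by (simp add: g_def)
  have upper: "g x - f x \<le> 2 * \<Phi> (x / 2)" if "x \<in> {0..b}" for x
  proof -
    have "g x \<le> f x + 2 * \<Phi> (x / 2)"
      unfolding g_def using that bound by (intro cSUP_least) auto
    then show ?thesis by simp
  qed
  \<comment> \<open>The supremum runs over a larger set as \<open>x\<close> grows.\<close>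
  have "mono_on {0..b} g"
    unfolding g_def using bdd by (intro mono_onI cSUP_subset_mono) auto
  moreover have "majorant_on {0..b} f g"
    unfolding majorant_on_def
  proof
    fix x assume x: "x \<in> {0..b}"
    have "0 \<le> \<Phi> x" using mod[of 0 x] x by simp
    with lower[OF x] show "f x \<le> g x" by simp
  qed
  ultimately show ?thesis using lower upper by blast
qed

theorem theorem3p6:
  fixes r a b :: real and f :: "real \<Rightarrow> real"
  assumes "0 < r" and "a < b" and "r_bounded_variation r f a b"
  shows "(r \<le> 1 \<longrightarrow> diff_of_monotone_on {a..b} f)
    \<and> (\<forall>h :: real \<Rightarrow> real. diff_of_monotone_on {a..b} h \<longrightarrow> r_bounded_variation 1 h a b)
    \<and> (1 < r \<and> Inf {a..b} = 0 \<and> concave_on {0..b - a} (variation_modulus r f a b) \<longrightarrow>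
        (\<exists>g :: real \<Rightarrow> real. mono_on {a..b} g \<and> majorant_on {a..b} f g \<and>
          (\<forall>x\<in>{a..b}. variation_modulus r f a b x \<le> g x - f x \<and>
                       g x - f x \<le> 2 * variation_modulus r f a b (x / 2))))"
proof (intro conjI impI allI)
  assume "r \<le> 1"
  with assms show "diff_of_monotone_on {a..b} f"
    by (intro bounded_variation_imp_diff_of_monotone_on)
next
  fix h :: "real \<Rightarrow> real"
  assume "diff_of_monotone_on {a..b} h"
  then show "r_bounded_variation 1 h a b"
    by (rule diff_of_monotone_on_imp_bounded_variation)
next
  assume A: "1 < r \<and> Inf {a..b} = 0 \<and> concave_on {0..b - a} (variation_modulus r f a b)"
  \<comment> \<open>With \<open>a = 0\<close> the domain \<open>{0..b - a}\<close> of the modulus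
    coincides with the interval \<open>{a..b}\<close> itself.\<close>
  with \<open>a < b\<close> have [simp]: "a = 0" by simp
  show "\<exists>g :: real \<Rightarrow> real. mono_on {a..b} g \<and> majorant_on {a..b} f g \<and>
          (\<forall>x\<in>{a..b}. variation_modulus r f a b x \<le> g x - f x \<and>
                       g x - f x \<le> 2 * variation_modulus r f a b (x / 2))"
    using concave_modulus_majorant[of b "variation_modulus r f a b" f] A
      abs_diff_le_variation_modulus[OF assms(1,3)] by simp
qed

end
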